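(* Let $n,k$ be positive integers such that $k>1$ and $k$ divides $n$, and let $A\in\mathbb{R}^{(n-k+1)\times n}$ and $B\in\mathbb{R}^{n\times n}$ be the matrices of valid and circular convolution with a box of width $k$, respectively. Then: (i) there exist $x\in\mathbb{R}^n$ with $|\operatorname{supp}(x)|=\frac{n}{k}$ and $y=Ax$ such that $x$ is not the unique minimizer of $\|w\|_0$ among all $w\in\mathbb{R}^n$ with $Aw=y$ (i.e. it is not the case that $\|x'\|_0>\|x\|_0$ for all $x'\neq x$ with $Ax'=y$); (ii) there exist $x\in\mathbb{R}^n$ with $|\operatorname{supp}(x)|=\frac{n}{k}$ and $y=Bx$ such that $x$ is not the unique minimizer of $\|w\|_0$ among all $w\in\mathbb{R}^n$ with $Bw=y$ (i.e. it is not the case that $\|x'\|_0>\|x\|_0$ for all $x'\neq x$ with $Bx'=y$).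
   Context: For $x\in\mathbb{R}^n$, $\operatorname{supp}(x)\subseteq\{1,\ldots,n\}$ is the set of indices where $x$ is nonzero, and $\|x\|_0=|\operatorname{supp}(x)|$. Valid convolution with a box of width $k$: $A$ is the $(n-k+1)\times n$ matrix with $(Ax)_i=x_i+x_{i+1}+\cdots+x_{i+k-1}$ for $1\le i\le n-k+1$. Circular convolution with a box of width $k$: $B$ is the $n\times n$ matrix with $(Bx)_i=\sum_{t=0}^{k-1}x_{i+t}$ for $1\le i\le n$, where indices are taken modulo $n$ with representatives in $\{1,\ldots,n\}$. (The first $n-k+1$ rows of $B$ are the rows of $A$.) *)

theory Defs
  imports Complex_Main "Jordan_Normal_Form.Matrix"
begin

text \<open>
  Vectors and matrices are indexed from 0, so the index i (between 1 and n) of the mathematical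
  text is the index i - 1 here; reduction modulo n then has representatives 0, ..., n - 1.
\<close>

definition supp_vec :: "real vec \<Rightarrow> nat set" where
  "supp_vec x = {i. i < dim_vec x \<and> x $ i \<noteq> 0}"

definition l0_norm :: "real vec \<Rightarrow> nat" where
  "l0_norm x = card (supp_vec x)"

text \<open>
  The convolution matrices are defined by their entries; \<open>valid_conv_mat_mult_vec\<close> and
  \<open>circ_conv_mat_mult_vec\<close> below give their action on vectors.
\<close>

definition valid_conv_mat :: "nat \<Rightarrow> nat \<Rightarrow> real mat" where
  "valid_conv_mat n k =
     mat (n - k + 1) n (\<lambda>(i, j). \<Sum>t<k. if j = i + t then 1 else 0)"

definition circ_conv_mat :: "nat \<Rightarrow> nat \<Rightarrow> real mat" where
  "circ_conv_mat n k =
     mat n n (\<lambda>(i, j). \<Sum>t<k. if j = (i + t) mod n then 1 else 0)"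

lemma valid_conv_mat_mult_vec:
  assumes "k \<le> n" "x \<in> carrier_vec n" "i < n - k + 1"
  shows "(valid_conv_mat n k *\<^sub>v x) $ i = (\<Sum>t<k. x $ (i + t))"
proof -
  have "(valid_conv_mat n k *\<^sub>v x) $ i
      = (\<Sum>j<n. (\<Sum>t<k. if j = i + t then 1 else 0) * x $ j)"
    using assms by (simp add: valid_conv_mat_def scalar_prod_def atLeast0LessThan)
  also have "\<dots> = (\<Sum>t<k. \<Sum>j<n. if j = i + t then x $ j else 0)"
    unfolding sum_distrib_right by (subst sum.swap) (intro sum.cong; simp)
  also have "\<dots> = (\<Sum>t<k. x $ (i + t))"
    using assms by (intro sum.cong) auto
  finally show ?thesis .
qed

lemma circ_conv_mat_mult_vec:
  assumes "x \<in> carrier_vec n" "i < n"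
  shows "(circ_conv_mat n k *\<^sub>v x) $ i = (\<Sum>t<k. x $ ((i + t) mod n))"
proof -
  have "(circ_conv_mat n k *\<^sub>v x) $ i
      = (\<Sum>j<n. (\<Sum>t<k. if j = (i + t) mod n then 1 else 0) * x $ j)"
    using assms by (simp add: circ_conv_mat_def scalar_prod_def atLeast0LessThan)
  also have "\<dots> = (\<Sum>t<k. \<Sum>j<n. if j = (i + t) mod n then x $ j else 0)"
    unfolding sum_distrib_right by (subst sum.swap) (intro sum.cong; simp)
  also have "\<dots> = (\<Sum>t<k. x $ ((i + t) mod n))"
    using assms by (intro sum.cong) auto
  finally show ?thesis .
qed

definition unique_l0_minimizer :: "real mat \<Rightarrow> real vec \<Rightarrow> real vec \<Rightarrow> bool" where
  "unique_l0_minimizer M y x \<longleftrightarrow>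
     x \<in> carrier_vec (dim_col M) \<and> M *\<^sub>v x = y \<and>
     (\<forall>x' \<in> carrier_vec (dim_col M). x' \<noteq> x \<and> M *\<^sub>v x' = y \<longrightarrow> l0_norm x' > l0_norm x)"

end

theory Submission
  imports Defs
begin

text \<open>
  Since k divides n, every window of k consecutive indices, circular or not, contains exactly one
  index of each residue class modulo k. So the indicator vectors of the classes of 0 and of 1 have
  the same (constant) convolution, and each has n / k nonzero entries.
\<close>

definition residue_vec :: "nat \<Rightarrow> nat \<Rightarrow> nat \<Rightarrow> real vec" where
  "residue_vec n k r = vec n (\<lambda>j. if j mod k = r then 1 else 0)"

lemma residue_vec_carrier: "residue_vec n k r \<in> carrier_vec n"
  by (simp add: residue_vec_def)

text \<open>The class is the bijective image of the quotients q < n div k under q \<mapsto> k * q +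
  r.\<close>

lemma card_residue_class:
  fixes n k r :: nat
  assumes "k dvd n" "r < k"
  shows "card {j. j < n \<and> j mod k = r} = n div k"
proof -
  obtain m where m: "n = k * m" using assms(1) by (elim dvdE)
  have "{j. j < n \<and> j mod k = r} = (\<lambda>q. k * q + r) ` {..<m}"
  proof (intro equalityI subsetI)
    fix j assume "j \<in> {j. j < n \<and> j mod k = r}"
    hence "j div k < m" "j = k * (j div k) + r"
      using m by (auto simp: less_mult_imp_div_less mult.commute)
    thus "j \<in> (\<lambda>q. k * q + r) ` {..<m}" by blast
  next
    fix j assume "j \<in> (\<lambda>q. k * q + r) ` {..<m}"
    then obtain q where q: "q < m" "j = k * q + r" by blast
    \<comment> \<open>Since k divides n, the last block of k indices is complete, so its element of
      residue r still lies below n.\<close>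
    have "k * q + r < k * Suc q" using assms(2) by simp
    also have "\<dots> \<le> k * m" using q(1) by (intro mult_le_mono2) simp
    finally show "j \<in> {j. j < n \<and> j mod k = r}" using q(2) m assms(2) by simp
  qed
  moreover have "inj_on (\<lambda>q. k * q + r) {..<m}"
    using assms(2) by (auto simp: inj_on_def)
  ultimately show ?thesis using m assms(2) by (simp add: card_image)
qed

lemma card_supp_residue_vec:
  assumes "k dvd n" "r < k"
  shows "card (supp_vec (residue_vec n k r)) = n div k"
proof -
  have "supp_vec (residue_vec n k r) = {j. j < n \<and> j mod k = r}"
    by (auto simp: supp_vec_def residue_vec_def split: if_splits)
  thus ?thesis using card_residue_class[OF assms] by simp
qed

text \<open>Shifting the window by one drops \<open>f i\<close> and gains \<open>f (i + k)\<close>,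
  which are equal, so induction carries every window back to the start 0.\<close>

lemma sum_window_periodic:
  fixes f :: "nat \<Rightarrow> 'a::cancel_comm_monoid_add"
  assumes "\<And>j. f (j + k) = f j"
  shows "(\<Sum>t<k. f (i + t)) = (\<Sum>t<k. f t)"
proof (induction i)
  case (Suc i)
  \<comment> \<open>The k + 1 terms from i on are split at the first term here and at the last term
    below; cancelling \<open>f i\<close> is what asks for a cancellative monoid.\<close>
  have "f i + (\<Sum>t<k. f (Suc i + t)) = (\<Sum>t<Suc k. f (i + t))"
    by (subst sum.lessThan_Suc_shift) simp
  also have "\<dots> = f i + (\<Sum>t<k. f (i + t))"
    using assms by (simp add: add.commute)
  finally show ?case using Suc by simp
qed simp

lemma sum_residue_window:
  fixes i k r :: nat
  assumes "r < k"
  shows "(\<Sum>t<k. if (i + t) mod k = r then 1 else 0 :: real) = 1"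
proof -
  have "(\<Sum>t<k. if (i + t) mod k = r then 1 else 0 :: real)
      = (\<Sum>t<k. if t mod k = r then 1 else 0)"
    by (rule sum_window_periodic[where f = "\<lambda>j. if j mod k = r then 1 else 0 :: real"]) simp
  \<comment> \<open>In the window that starts at 0, each t is its own residue, so exactly one
    summand is 1.\<close>
  also have "\<dots> = (\<Sum>t<k. if t = r then 1 else 0)" by (intro sum.cong) auto
  finally show ?thesis using assms by simp
qed

lemma valid_conv_residue_vec:
  assumes "k \<le> n" "r < k"
  shows "valid_conv_mat n k *\<^sub>v residue_vec n k r = vec (n - k + 1) (\<lambda>_. 1)"
proof (rule eq_vecI)
  fix i assume "i < dim_vec (vec (n - k + 1) (\<lambda>_. 1 :: real))"
  hence i: "i < n - k + 1" by simp
  have "(valid_conv_mat n k *\<^sub>v residue_vec n k r) $ i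
      = (\<Sum>t<k. residue_vec n k r $ (i + t))"
    using assms(1) residue_vec_carrier i by (rule valid_conv_mat_mult_vec)
  \<comment> \<open>The bound on i keeps i + t below n, so every entry read is a genuine
    one.\<close>
  also have "\<dots> = (\<Sum>t<k. if (i + t) mod k = r then 1 else 0)"
    using i assms(1) by (intro sum.cong) (auto simp: residue_vec_def)
  also have "\<dots> = 1" using assms(2) by (rule sum_residue_window)
  finally show "(valid_conv_mat n k *\<^sub>v residue_vec n k r) $ i = vec (n - k + 1) (\<lambda>_. 1) $ i"
    using i by simp
qed (simp add: valid_conv_mat_def)

lemma circ_conv_residue_vec:
  assumes "k dvd n" "r < k"
  shows "circ_conv_mat n k *\<^sub>v residue_vec n k r = vec n (\<lambda>_. 1)"
proof (rule eq_vecI)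
  fix i assume "i < dim_vec (vec n (\<lambda>_. 1 :: real))"
  hence i: "i < n" by simp
  have "(circ_conv_mat n k *\<^sub>v residue_vec n k r) $ i
      = (\<Sum>t<k. residue_vec n k r $ ((i + t) mod n))"
    using residue_vec_carrier i by (rule circ_conv_mat_mult_vec)
  \<comment> \<open>Wrapping around modulo n preserves residues modulo k because k divides
    n.\<close>
  also have "\<dots> = (\<Sum>t<k. if (i + t) mod k = r then 1 else 0)"
    using i assms(1) by (intro sum.cong) (auto simp: residue_vec_def mod_mod_cancel)
  also have "\<dots> = 1" using assms(2) by (rule sum_residue_window)
  finally show "(circ_conv_mat n k *\<^sub>v residue_vec n k r) $ i = vec n (\<lambda>_. 1) $ i"
    using i by simp
qed (simp add: circ_conv_mat_def)

lemma not_unique_l0_minimizerI: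
  assumes "x' \<in> carrier_vec (dim_col M)" "x' \<noteq> x" "M *\<^sub>v x' = y" "l0_norm x' \<le> l0_norm x"
  shows "\<not> unique_l0_minimizer M y x"
  using assms by (fastforce simp: unique_l0_minimizer_def)

theorem mainTheorem3:
  fixes n k :: nat
  assumes "n > 0" and "k > 1" and "k dvd n"
  shows "(\<exists>x \<in> carrier_vec n. \<exists>y.
            card (supp_vec x) = n div k \<and> y = valid_conv_mat n k *\<^sub>v x \<and>
            \<not> unique_l0_minimizer (valid_conv_mat n k) y x)
       \<and> (\<exists>x \<in> carrier_vec n. \<exists>y.
            card (supp_vec x) = n div k \<and> y = circ_conv_mat n k *\<^sub>v x \<and>
            \<not> unique_l0_minimizer (circ_conv_mat n k) y x)"
proof -
  let ?x = "residue_vec n k 0" and ?x' = "residue_vec n k 1"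
  have k: "0 < k" "1 < k" "k \<le> n" using assms by (auto intro: dvd_imp_le)
  \<comment> \<open>Index 0 exists as n > 0; the entries there are 1 and 0.\<close>
  have "?x $ 0 \<noteq> ?x' $ 0" using assms by (simp add: residue_vec_def)
  hence ne: "?x' \<noteq> ?x" by auto
  have card: "card (supp_vec ?x) = n div k" and l0: "l0_norm ?x' \<le> l0_norm ?x"
    using k assms(3) by (simp_all add: l0_norm_def card_supp_residue_vec)
  \<comment> \<open>Both matrices are treated at once: a competitor with the same image and equally
    small support already refutes uniqueness.\<close>
  have "\<not> unique_l0_minimizer M (M *\<^sub>v ?x) ?x"
    if "dim_col M = n" "M *\<^sub>v ?x' = M *\<^sub>v ?x" for M
    using that ne l0 by (intro not_unique_l0_minimizerI[of ?x']) (auto simp: residue_vec_carrier)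
  moreover have "dim_col (valid_conv_mat n k) = n" "dim_col (circ_conv_mat n k) = n"
    by (simp_all add: valid_conv_mat_def circ_conv_mat_def)
  moreover have "valid_conv_mat n k *\<^sub>v ?x' = valid_conv_mat n k *\<^sub>v ?x"
    "circ_conv_mat n k *\<^sub>v ?x' = circ_conv_mat n k *\<^sub>v ?x"
    using k assms(3) by (simp_all only: valid_conv_residue_vec circ_conv_residue_vec)
  ultimately show ?thesis using card residue_vec_carrier by blast
qed

end
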